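(* There exists an infinite class $\mathcal{C}$ of bipartite graphs such that every $n$-vertex graph $G$ in $\mathcal{C}$ satisfies $\mathrm{xc}(\mathrm{STAB}(G)) = \Omega(n \log n)$.
   Context: The extension complexity $\mathrm{xc}(P)$ of a polytope $P$ is the minimum number of facets of a polytope that affinely projects to $P$. For a graph $G$, $\mathrm{STAB}(G)$ denotes the stable set polytope of $G$, i.e. the convex hull of the characteristic vectors of the stable sets of $G$. *)

theory Defs
  imports
    "HOL-Analysis.Analysis"
    "HOL-Analysis.Finite_Function_Topology"
    "Graph_Theory.Pair_Digraph"
    "Graph_Theory.Digraph_Isomorphism"
begin

text \<open>
  All polytopes live in spaces \<^typ>\<open>'i \<Rightarrow>\<^sub>0 real\<close> of finitely supported vectors. The space
  \<^typ>\<open>nat \<Rightarrow>\<^sub>0 real\<close> contains a copy of \<open>\<real>\<^sup>d\<close> for every \<open>d\<close>, and each of its polytopes spans a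
  finite-dimensional subspace, so quantifying over polytopes in it amounts to quantifying over
  polytopes in Euclidean spaces of every dimension. The library's notions of convex hull, face
  and polytope apply there, but its affine dimension and facets are restricted to the class
  \<^class>\<open>euclidean_space\<close>; the next two definitions lift that restriction.
\<close>

definition affine_dim :: "'a::real_vector set \<Rightarrow> int" where
  "affine_dim S =
    (SOME d. \<exists>B. affine hull B = affine hull S \<and> \<not> affine_dependent B \<and> of_nat (card B) = d + 1)"

definition facet :: "'a::real_vector set \<Rightarrow> 'a set \<Rightarrow> bool" where
  "facet F P \<longleftrightarrow> F face_of P \<and> F \<noteq> {} \<and> affine_dim F = affine_dim P - 1"

lemma affine_dim_eq_aff_dim: "affine_dim (S :: 'a::euclidean_space set) = aff_dim S"
  by (simp add: affine_dim_def aff_dim_def)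

lemma facet_iff_facet_of: "facet (F :: 'a::euclidean_space set) P \<longleftrightarrow> F facet_of P"
  by (simp add: facet_def facet_of_def affine_dim_eq_aff_dim)

text \<open>
  The affine projection is \<open>x \<mapsto> b + f x\<close> with \<open>f\<close> linear; an affine map defined only on the
  affine hull of \<open>Q\<close> extends to the whole space, so requiring it everywhere is no restriction.
\<close>

definition xc :: "'a::real_vector set \<Rightarrow> nat" where
  "xc P = (LEAST k. \<exists>(Q :: (nat \<Rightarrow>\<^sub>0 real) set) f b.
     polytope Q \<and> linear f \<and> (\<lambda>x. b + f x) ` Q = P \<and> card {F. facet F Q} = k)"

text \<open>
  A finite simple graph is a \<^locale>\<open>pair_graph\<close>, in which an edge between \<open>u\<close> and \<open>v\<close> is
  the pair of arcs \<open>(u, v)\<close> and \<open>(v, u)\<close>.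
\<close>

definition bipartite :: "'v pair_pre_digraph \<Rightarrow> bool" where
  "bipartite G \<longleftrightarrow>
    (\<exists>A B. A \<union> B = pverts G \<and> A \<inter> B = {} \<and> parcs G \<subseteq> A \<times> B \<union> B \<times> A)"

definition stable_set :: "'v pair_pre_digraph \<Rightarrow> 'v set \<Rightarrow> bool" where
  "stable_set G S \<longleftrightarrow> S \<subseteq> pverts G \<and> (\<forall>u\<in>S. \<forall>v\<in>S. (u, v) \<notin> parcs G)"

definition char_vec :: "'v set \<Rightarrow> 'v \<Rightarrow>\<^sub>0 real" where
  "char_vec S = (\<Sum>v\<in>S. Poly_Mapping.single v 1)"

lemma lookup_char_vec:
  "finite S \<Longrightarrow> Poly_Mapping.lookup (char_vec S) v = (if v \<in> S then 1 else 0)"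
  by (simp add: char_vec_def lookup_sum lookup_single when_def)

definition STAB :: "'v pair_pre_digraph \<Rightarrow> ('v \<Rightarrow>\<^sub>0 real) set" where
  "STAB G = convex hull (char_vec ` {S. stable_set G S})"

end

theory Submission
  imports Defs
begin

text \<open>
  A facet \<open>F\<close> of an extension of \<open>STAB(G)\<close> determines a vertex set \<open>U\<close>, the union of the edges
  whose tight face lies in \<open>F\<close>, and the sets \<open>U\<close> cover all pairs of an edge \<open>e\<close> and a stable
  set \<open>S\<close> disjoint from \<open>e\<close> in the sense that \<open>e \<subseteq> U\<close> and \<open>U \<inter> S = {}\<close> for some \<open>U\<close>. So it
  suffices to bound the size of such covers from below.

  Let \<open>G\<close> be the incidence graph of \<open>\<Theta>(q\<^sup>3)\<close> points and lines, with \<open>q\<close> lines through each point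
  and at most one line through two points. Select each line independently with probability \<open>1/k\<close>,
  where \<open>k = q/j\<close> and \<open>j = \<Theta>(log q)\<close>, and let \<open>S\<close> consist of the selected lines and the points
  on none of them. Of the \<open>q\<^sup>4\<close> flags a constant proportion is expected to be disjoint from \<open>S\<close>,
  while each \<open>U\<close>, say with points \<open>X\<close> and lines \<open>Y\<close>, covers at most \<open>2k\<close> of them in expectation:
  \<open>Y\<close> must avoid the selection, which limits \<open>|Y|\<close> to about \<open>k\<close>, and every point of \<open>X\<close> must be
  hit, which a point fails with probability about \<open>exp (- j)\<close>, a small negative power of \<open>q\<close>, so
  that a large \<open>X\<close> survives only if some line with two points of \<open>X\<close> is selected. Hence the cover has
  \<open>\<Omega>(q\<^sup>4/k) = \<Omega>(q\<^sup>3 log q)\<close> members.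
\<close>

section \<open>Facets of polytopes in real vector spaces\<close>

text \<open>If \<open>x\<close> in \<open>F\<close> is a convex combination of \<open>V\<close> in
  which \<open>v\<close> has positive weight, then \<open>x\<close> is \<open>v\<close> or lies
  strictly between \<open>v\<close> and the normalised rest of the combination, so the face property
  puts \<open>v\<close> into \<open>F\<close>.\<close>

lemma face_of_convex_hull_eq_convex_hull_Int:
  fixes V :: "'a::real_vector set"
  assumes fin: "finite V" and F: "F face_of convex hull V"
  shows "F = convex hull (F \<inter> V)"
proof
  show "convex hull (F \<inter> V) \<subseteq> F"
    using F by (intro hull_minimal) (auto simp: face_of_def)
  show "F \<subseteq> convex hull (F \<inter> V)"
  proof
    fix x assume x: "x \<in> F"
    with F have "x \<in> convex hull V"
      by (auto simp: face_of_def)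
    then obtain u where u0: "\<And>v. v \<in> V \<Longrightarrow> 0 \<le> u v" and u1: "sum u V = 1"
      and ux: "(\<Sum>v\<in>V. u v *\<^sub>R v) = x"
      unfolding convex_hull_finite[OF fin] by auto
    have inF: "v \<in> F" if v: "v \<in> V" and pos: "u v > 0" for v
    proof (cases "sum u (V - {v}) = 0")
      case True
      then have "u w = 0" if "w \<in> V - {v}" for w
        using that fin u0 by (subst (asm) sum_nonneg_eq_0_iff) auto
      then have "(\<Sum>w\<in>V. u w *\<^sub>R w) = u v *\<^sub>R v" "u v = 1"
        using v u1 True by (auto simp: sum.remove[OF fin v])
      then show ?thesis using x ux by simp
    next
      case False
      define s where "s = sum u (V - {v})"
      have s: "s > 0" "u v = 1 - s"
        using False u1 u0 v by (auto simp: s_def sum.remove[OF fin v] less_le intro: sum_nonneg)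
      define y where "y = (\<Sum>w\<in>V - {v}. (u w / s) *\<^sub>R w)"
      have y: "y \<in> convex hull V"
      proof -
        have "y \<in> convex hull (V - {v})"
          unfolding y_def using fin s u0
          by (intro convex_sum[OF _ convex_convex_hull])
            (auto simp: sum_divide_distrib[symmetric] hull_inc s_def)
        then show ?thesis
          using hull_mono[of "V - {v}" V convex] by auto
      qed
      have "x = u v *\<^sub>R v + s *\<^sub>R y"
        unfolding ux[symmetric] y_def sum.remove[OF fin v] scaleR_sum_right
        using s by simp
      then have xs: "x = (1 - s) *\<^sub>R v + s *\<^sub>R y" using s by simp
      show ?thesis
      proof (cases "y = v")
        case True
        with xs x show ?thesis by (simp add: scaleR_left_distrib[symmetric])
      next
        case False
        have "x \<in> open_segment v y"
          unfolding in_segment using False xs s pos by (intro conjI exI[of _ s]) auto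
        then show ?thesis
          using F x y v by (meson face_ofD hull_inc)
      qed
    qed
    have "x = (\<Sum>v\<in>F \<inter> V. u v *\<^sub>R v)"
      unfolding ux[symmetric] using fin inF u0
      by (intro sum.mono_neutral_right) (auto simp: less_le)
    moreover have "sum u (F \<inter> V) = 1"
      unfolding u1[symmetric] using fin inF u0
      by (intro sum.mono_neutral_left) (auto simp: less_le)
    ultimately show "x \<in> convex hull (F \<inter> V)"
      using fin u0 unfolding convex_hull_finite[OF finite_Int[OF disjI2[OF fin]]] by auto
  qed
qed

lemma finite_faces_of_convex_hull:
  fixes V :: "'a::real_vector set"
  assumes "finite V"
  shows "finite {F. F face_of convex hull V}"
proof (rule finite_subset)
  show "{F. F face_of convex hull V} \<subseteq> (\<lambda>W. convex hull W) ` Pow V"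
    using face_of_convex_hull_eq_convex_hull_Int[OF assms] by blast
qed (use assms in simp)

lemma face_of_supporting_hyperplane:
  fixes g :: "'a::real_vector \<Rightarrow> real"
  assumes g: "linear g" and "convex S" and le: "\<And>x. x \<in> S \<Longrightarrow> g x \<le> \<beta>"
  shows "{x \<in> S. g x = \<beta>} face_of S"
proof -
  interpret g: linear g by fact
  have "convex {x \<in> S. g x = \<beta>}"
    using assms(2) unfolding convex_def
    by (auto simp: g.add g.scale distrib_right[symmetric])
  moreover have "g a = \<beta> \<and> g b = \<beta>"
    if ab: "a \<in> S" "b \<in> S" and x: "g x = \<beta>" "x \<in> open_segment a b" for a b x
  proof -
    obtain u where u: "0 < u" "u < 1" "x = (1 - u) *\<^sub>R a + u *\<^sub>R b"
      using x by (auto simp: in_segment)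
    then have "\<beta> = (1 - u) * g a + u * g b"
      using x(1) by (simp only: g.add g.scale real_scaleR_def)
    then have "(1 - u) * (\<beta> - g a) + u * (\<beta> - g b) = 0"
      by (simp add: algebra_simps)
    moreover have "(1 - u) * (\<beta> - g a) \<ge> 0" "u * (\<beta> - g b) \<ge> 0"
      using u le ab by auto
    ultimately have "(1 - u) * (\<beta> - g a) = 0" "u * (\<beta> - g b) = 0"
      by linarith+
    then show ?thesis using u by auto
  qed
  ultimately show ?thesis
    unfolding face_of_def by blast
qed

section \<open>Affine independence and affine dimension\<close>

text \<open>Moving a point of \<open>C\<close> and a point of \<open>B\<close> to the origin reduces
  this to the exchange bound for linear independence.\<close>

lemma affine_independent_card_le:
  fixes B :: "'a::real_vector set"
  assumes fin: "finite B" and ind: "\<not> affine_dependent C" and sub: "C \<subseteq> affine hull B"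
  shows "finite C \<and> card C \<le> card B"
proof (cases "C = {}")
  case False
  then obtain a where a: "a \<in> C" by blast
  with sub have "B \<noteq> {}" by auto
  then obtain b where b: "b \<in> B" by blast
  let ?D = "(\<lambda>x. - b + x) ` (B - {b})" and ?E = "(\<lambda>x. - a + x) ` (C - {a})"
  have hull: "- b + x \<in> span ?D" if "x \<in> C" for x
    using that sub affine_hull_span2[OF b] by auto
  have "?E \<subseteq> span ?D"
  proof
    fix y assume "y \<in> ?E"
    then obtain x where "x \<in> C" "y = (- b + x) - (- b + a)" by auto
    then show "y \<in> span ?D" using hull a by (metis span_diff)
  qed
  moreover have "independent ?E"
    using ind affine_dependent_iff_dependent2[OF a] by blast
  ultimately have E: "finite ?E" "card ?E \<le> card ?D"
    using independent_span_bound[of ?D ?E] fin by auto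
  have "inj_on (\<lambda>x. - a + x) (C - {a})" "inj_on (\<lambda>x. - b + x) (B - {b})"
    by (auto simp: inj_on_def)
  with E have "finite (C - {a})" "card (C - {a}) \<le> card (B - {b})"
    by (auto simp: card_image dest: finite_imageD)
  moreover from this have "finite C" by simp
  ultimately show ?thesis
    using a b fin card_Suc_Diff1[of C a] card_Suc_Diff1[of B b] by simp
qed auto

lemma not_affine_dependent_insert:
  fixes B :: "'a::real_vector set"
  assumes B: "\<not> affine_dependent B" and v: "v \<notin> affine hull B"
  shows "\<not> affine_dependent (insert v B)"
proof (cases "B = {}")
  case False
  then obtain b where b: "b \<in> B" by blast
  let ?D = "(\<lambda>x. - b + x) ` (B - {b})"
  have "v \<noteq> b" using v b hull_inc by metis
  have "- b + v \<notin> span ?D"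
  proof
    assume "- b + v \<in> span ?D"
    then have "b + (- b + v) \<in> affine hull B"
      using affine_hull_span2[OF b] by blast
    with v show False by simp
  qed
  moreover have "independent ?D"
    using B affine_dependent_iff_dependent2[OF b] by blast
  ultimately have "independent (insert (- b + v) ?D)"
    by (simp add: independent_insert)
  moreover have "insert (- b + v) ?D = (\<lambda>x. - b + x) ` (insert v B - {b})"
    using \<open>v \<noteq> b\<close> by auto
  ultimately show ?thesis
    using affine_dependent_iff_dependent2[of b "insert v B"] b by simp
qed auto

text \<open>The exchange bound applies in both directions, so the choice in
  \<open>affine_dim\<close> has only one candidate. It also rules out infinite bases, whose
  \<open>card\<close> would be 0.\<close>

lemma affine_dim_eq_card:
  fixes B :: "'a::real_vector set"
  assumes "finite B" "\<not> affine_dependent B" "affine hull B = affine hull S"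
  shows "affine_dim S = int (card B) - 1"
  unfolding affine_dim_def
proof (rule some_equality)
  show "\<exists>B'. affine hull B' = affine hull S \<and> \<not> affine_dependent B' \<and> int (card B') = int (card B) - 1 + 1"
    using assms by auto
next
  fix d assume "\<exists>B'. affine hull B' = affine hull S \<and> \<not> affine_dependent B' \<and> int (card B') = d + 1"
  then obtain B' where B': "affine hull B' = affine hull S" "\<not> affine_dependent B'" "int (card B') = d + 1"
    by blast
  have "finite B' \<and> card B' \<le> card B"
    using assms B' affine_independent_card_le[of B B'] by (metis hull_subset)
  moreover from this have "card B \<le> card B'"
    using assms B' affine_independent_card_le[of B' B] by (metis hull_subset)
  ultimately show "d = int (card B) - 1" using B' by simp
qed

section \<open>Separating functionals and facets\<close>

lemma linear_functional_separating_span: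
  fixes w :: "'a::real_vector"
  assumes "w \<notin> span D"
  obtains h :: "'a \<Rightarrow> real" where "linear h" "\<And>x. x \<in> D \<Longrightarrow> h x = 0" "h w = 1"
proof -
  obtain C where C: "C \<subseteq> D" "independent C" "D \<subseteq> span C"
    using maximal_independent_subset by blast
  have w: "w \<notin> span C" using assms C(1) span_mono by blast
  then have "independent (insert w C)"
    using C(2) by (simp add: independent_insert)
  then obtain h :: "'a \<Rightarrow> real" where h: "linear h" "\<forall>x\<in>insert w C. h x = (if x = w then 1 else 0)"
    using linear_independent_extend[of "insert w C" "\<lambda>x. if x = w then 1 else (0::real)"] by blast
  have "h x = 0" if "x \<in> D" for x
  proof (rule linear_eq_0_on_span[OF h(1)])
    show "x \<in> span C" using C that by blast
    show "\<And>y. y \<in> C \<Longrightarrow> h y = 0" using h(2) w by (auto simp: span_base)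
  qed
  with h that show ?thesis by auto
qed

lemma linear_le_on_convex_hull:
  fixes g :: "'a::real_vector \<Rightarrow> real"
  assumes g: "linear g" and le: "\<And>v. v \<in> V \<Longrightarrow> g v \<le> \<beta>" and x: "x \<in> convex hull V"
  shows "g x \<le> \<beta>"
proof -
  interpret g: linear g by fact
  have "convex {x. g x \<le> \<beta>}"
    unfolding convex_def by (auto simp: g.add g.scale intro: convex_bound_le)
  then have "convex hull V \<subseteq> {x. g x \<le> \<beta>}"
    using le by (intro hull_minimal) auto
  with x show ?thesis by auto
qed

text \<open>Starting from any supporting hyperplane avoiding \<open>z\<close>, tilt it around the face it cuts out
  until it meets a further point of \<open>V\<close>; of the two directions of tilting, one keeps \<open>z\<close> off.\<close>

lemma facet_avoiding_point:
  fixes V :: "'a::real_vector set" and g :: "'a \<Rightarrow> real"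
  assumes "finite V" "linear g" "\<And>v. v \<in> V \<Longrightarrow> g v \<le> \<beta>"
    and "z \<in> convex hull V" "g z < \<beta>" "\<exists>x\<in>convex hull V. g x = \<beta>"
  shows "\<exists>F. facet F (convex hull V) \<and> {x \<in> convex hull V. g x = \<beta>} \<subseteq> F \<and> z \<notin> F"
  using assms
proof (induction "card {v \<in> V. g v < \<beta>}" arbitrary: g \<beta> rule: less_induct)
  case less
  note fin = \<open>finite V\<close> and g = \<open>linear g\<close> and le = \<open>\<And>v. v \<in> V \<Longrightarrow> g v \<le> \<beta>\<close>
  interpret g: linear g by fact
  define F where "F = {x \<in> convex hull V. g x = \<beta>}"
  define V0 where "V0 = {v \<in> V. g v = \<beta>}"
  define V1 where "V1 = {v \<in> V. g v < \<beta>}"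
  have face: "F face_of convex hull V"
    unfolding F_def by (intro face_of_supporting_hyperplane g linear_le_on_convex_hull[OF g le]) auto
  have FV0: "F = convex hull V0"
  proof -
    have "F \<inter> V = V0" by (auto simp: F_def V0_def hull_inc)
    then show ?thesis using face_of_convex_hull_eq_convex_hull_Int[OF fin face] by simp
  qed
  have ne: "F \<noteq> {}" using less.prems(6) by (auto simp: F_def)
  have zF: "z \<notin> F" using less.prems by (auto simp: F_def)
  \<comment> \<open>If every point of \<open>V\<close> were tight, \<open>F\<close> would be the
    whole hull and contain \<open>z\<close>.\<close>
  have "V1 \<noteq> {}"
  proof
    assume "V1 = {}"
    then have "V0 = V" using le by (force simp: V0_def V1_def)
    with FV0 zF less.prems show False by simp
  qed
  then obtain v where v: "v \<in> V1" by blast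
  obtain B where B: "B \<subseteq> V0" "\<not> affine_dependent B" "affine hull V0 = affine hull B"
    using affine_basis_exists by blast
  have finB: "finite B" using B(1) fin by (auto simp: V0_def intro: finite_subset)
  have hullF: "affine hull B = affine hull F"
    using B FV0 by simp
  have "B \<noteq> {}" using hullF ne by auto
  then obtain b where b: "b \<in> B" by blast
  have gB: "g x = \<beta>" if "x \<in> affine hull B" for x
  proof -
    have "affine {x. g x = \<beta>}"
      unfolding affine_def by (auto simp: g.add g.scale distrib_right[symmetric])
    then have "affine hull B \<subseteq> {x. g x = \<beta>}"
      using B by (intro hull_minimal) (auto simp: V0_def)
    with that show ?thesis by auto
  qed
  have vB: "v \<notin> affine hull B"
    using gB v by (auto simp: V1_def)
  show ?case
  proof (cases "V \<subseteq> affine hull (insert v B)")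
    \<comment> \<open>\<open>F\<close> and the single further point \<open>v\<close> span the affine
      hull of \<open>V\<close>, so \<open>F\<close> has codimension one.\<close>
    case True
    have "\<not> affine_dependent (insert v B)"
      using B(2) vB by (rule not_affine_dependent_insert)
    moreover have "affine hull (insert v B) = affine hull (convex hull V)"
    proof -
      have "affine hull (insert v B) \<subseteq> affine hull V"
        using B v by (intro hull_mono) (auto simp: V0_def V1_def)
      moreover have "affine hull V \<subseteq> affine hull (insert v B)"
        using True by (intro hull_minimal) auto
      ultimately show ?thesis by simp
    qed
    ultimately have "affine_dim (convex hull V) = int (card (insert v B)) - 1"
      using finB by (intro affine_dim_eq_card) auto
    moreover have "affine_dim F = int (card B) - 1"
      using finB B hullF by (intro affine_dim_eq_card) auto
    moreover have "v \<notin> B" using vB hull_inc by metis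
    ultimately have "facet F (convex hull V)"
      using face ne finB by (simp add: facet_def)
    then show ?thesis using zF by (auto simp: F_def)
  next
    case False
    then obtain w where w: "w \<in> V" "w \<notin> affine hull (insert v B)" by blast
    \<comment> \<open>A functional that is constant on \<open>insert v B\<close> but larger at
      \<open>w\<close> gives a direction of tilting in which \<open>v\<close> and \<open>w\<close>
      do not become tight together.\<close>
    have "- b + w \<notin> span ((\<lambda>x. - b + x) ` insert v B)"
    proof
      assume "- b + w \<in> span ((\<lambda>x. - b + x) ` insert v B)"
      moreover have "b \<in> affine hull (insert v B)" using b by (intro hull_inc) auto
      ultimately have "b + (- b + w) \<in> affine hull (insert v B)"
        using affine_hull_span_gen by blast
      with w show False by simp
    qed
    then obtain h :: "'a \<Rightarrow> real" where h: "linear h"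
      "\<And>x. x \<in> insert v B \<Longrightarrow> h (- b + x) = 0" "h (- b + w) = 1"
      using linear_functional_separating_span by (metis (no_types, lifting) image_eqI)
    have hB: "h x = h b" if "x \<in> insert v B" for x
      using h(2)[OF that] h(1) by (simp add: linear_diff)
    have hw: "h w = h b + 1"
      using h(3) h(1) by (simp add: linear_diff)
    have hV0: "h x = h b" if "x \<in> V0" for x
    proof -
      interpret h: linear h by fact
      have "affine {x. h x = h b}"
        unfolding affine_def by (auto simp: h.add h.scale distrib_right[symmetric])
      then have "affine hull B \<subseteq> {x. h x = h b}"
        using hB by (intro hull_minimal) auto
      moreover have "x \<in> affine hull B"
        using that B(3) hull_inc by metis
      ultimately show ?thesis by auto
    qed
    have wV1: "w \<in> V1"
      using w hw hV0[of w] le[of w] by (force simp: V0_def V1_def)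
    have tilt: ?thesis if f: "linear f" "\<And>x. x \<in> V0 \<Longrightarrow> f x = f b"
      and M: "\<And>x. x \<in> V1 \<Longrightarrow> f x - f b \<le> M * (\<beta> - g x)"
      and u: "u \<in> V1" "f u - f b = M * (\<beta> - g u)"
      and z: "f z - f b \<noteq> M * (\<beta> - g z)" for f M u
    proof -
      let ?g = "\<lambda>x. f x + M * g x" and ?\<beta> = "f b + M * \<beta>"
      have lin: "linear ?g"
        using f(1) linear_compose_scale_right[OF g, of M]
        by (intro linear_compose_add) simp_all
      have le': "?g x \<le> ?\<beta>" if "x \<in> V" for x
      proof (cases "x \<in> V0")
        case True
        then show ?thesis using f(2)[OF True] by (simp add: V0_def)
      next
        case False
        then have "x \<in> V1" using that le[of x] by (auto simp: V0_def V1_def)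
        then show ?thesis using M[of x] by (simp add: algebra_simps)
      qed
      have eq0: "?g x = ?\<beta>" if "x \<in> V0" for x
        using that f(2)[OF that] by (simp add: V0_def)
      have "{x \<in> V. ?g x < ?\<beta>} \<subset> {x \<in> V. g x < \<beta>}"
      proof
        show "{x \<in> V. ?g x < ?\<beta>} \<subseteq> {x \<in> V. g x < \<beta>}"
        proof clarify
          fix x assume x: "x \<in> V" "?g x < ?\<beta>"
          then have "x \<notin> V0" using eq0[of x] by auto
          with x le[of x] show "g x < \<beta>" by (auto simp: V0_def)
        qed
        show "{x \<in> V. ?g x < ?\<beta>} \<noteq> {x \<in> V. g x < \<beta>}"
        proof -
          have "u \<in> {x \<in> V. g x < \<beta>}" using u by (simp add: V1_def)
          moreover have "u \<notin> {x \<in> V. ?g x < ?\<beta>}" using u by (simp add: algebra_simps)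
          ultimately show ?thesis by blast
        qed
      qed
      then have card: "card {x \<in> V. ?g x < ?\<beta>} < card {x \<in> V. g x < \<beta>}"
        using fin by (intro psubset_card_mono) auto
      have "?g z \<le> ?\<beta>"
        using linear_le_on_convex_hull[OF lin le'] less.prems by blast
      then have z': "?g z < ?\<beta>" using z by (simp add: algebra_simps less_le)
      interpret l: linear ?g by fact
      have "convex {x. ?g x = ?\<beta>}"
        unfolding convex_def by (simp only: l.add l.scale mem_Collect_eq) (simp add: distrib_right[symmetric])
      then have "F \<subseteq> {x. ?g x = ?\<beta>}"
        unfolding FV0 using eq0 by (intro hull_minimal) auto
      then have sub: "F \<subseteq> {x \<in> convex hull V. ?g x = ?\<beta>}"
        by (auto simp: F_def)
      then have "\<exists>x\<in>convex hull V. ?g x = ?\<beta>" using ne by auto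
      then obtain F' where "facet F' (convex hull V)" "{x \<in> convex hull V. ?g x = ?\<beta>} \<subseteq> F'" "z \<notin> F'"
        using less.hyps[OF card fin lin le' less.prems(4) z'] by auto
      then show ?thesis using sub unfolding F_def by blast
    qed
    \<comment> \<open>The ratio is the multiple of \<open>g\<close> at which the slack point
      \<open>x\<close> becomes tight; the maximum serves the direction \<open>h\<close>, the minimum
      the direction \<open>- h\<close>.\<close>
    let ?\<rho> = "\<lambda>x. (h x - h b) / (\<beta> - g x)"
    have finV1: "finite V1" using fin by (simp add: V1_def)
    define M where "M = Max (?\<rho> ` V1)"
    define m where "m = Min (?\<rho> ` V1)"
    have "M \<in> ?\<rho> ` V1" unfolding M_def using finV1 v by (intro Max_in) auto
    then obtain u where u: "u \<in> V1" "M = ?\<rho> u" by auto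
    have "m \<in> ?\<rho> ` V1" unfolding m_def using finV1 v by (intro Min_in) auto
    then obtain u' where u': "u' \<in> V1" "m = ?\<rho> u'" by auto
    have pos: "\<beta> - g x > 0" if "x \<in> V1" for x using that by (simp add: V1_def)
    have Mm: "?\<rho> x \<le> M" "m \<le> ?\<rho> x" if "x \<in> V1" for x
      unfolding M_def m_def using that finV1 by (auto intro: Max_ge Min_le)
    have "M \<noteq> m"
    proof
      assume "M = m"
      then have "?\<rho> w = ?\<rho> v" using Mm[OF v] Mm[OF wV1] by linarith
      then show False using hw hB[of v] pos[OF wV1] by simp
    qed
    \<comment> \<open>Since \<open>\<beta> - g z\<close> is positive, \<open>z\<close> becomes tight
      for at most one of two distinct multiples.\<close>
    then have "h z - h b \<noteq> M * (\<beta> - g z) \<or> h z - h b \<noteq> m * (\<beta> - g z)"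
      using less.prems(5) by auto
    then show ?thesis
    proof
      assume z: "h z - h b \<noteq> M * (\<beta> - g z)"
      show ?thesis
      proof (rule tilt[OF h(1) hV0 _ u(1) _ z])
        show "h x - h b \<le> M * (\<beta> - g x)" if "x \<in> V1" for x
          using Mm(1)[OF that] pos[OF that] by (simp add: pos_divide_le_eq)
        show "h u - h b = M * (\<beta> - g u)"
          using u(2) pos[OF u(1)] by simp
      qed
    next
      assume z: "h z - h b \<noteq> m * (\<beta> - g z)"
      let ?h = "\<lambda>x. - h x"
      show ?thesis
      proof (rule tilt[where f = ?h and M = "- m" and u = u'])
        show "linear ?h" using h(1) by (rule linear_compose_neg)
        show "- h x = - h b" if "x \<in> V0" for x using hV0[OF that] by simp
        show "- h x - - h b \<le> - m * (\<beta> - g x)" if "x \<in> V1" for x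
          using Mm(2)[OF that] pos[OF that] by (simp add: pos_le_divide_eq)
        show "- h u' - - h b = - m * (\<beta> - g u')"
          using u'(2) pos[OF u'(1)] by simp
        show "- h z - - h b \<noteq> - m * (\<beta> - g z)" using z by auto
      qed (rule u'(1))
    qed
  qed
qed


section \<open>Rectangle covers from extensions\<close>

lemma lookup_scaleR:
  "Poly_Mapping.lookup (r *\<^sub>R x) i = r *\<^sub>R Poly_Mapping.lookup x i"
proof -
  have "finite {i. r *\<^sub>R Poly_Mapping.lookup x i \<noteq> 0}"
    using finite_lookup[of x] by (rule rev_finite_subset) auto
  then show ?thesis
    by (simp add: scaleR_poly_mapping_def Abs_poly_mapping_inverse)
qed

lemma char_vec_in_STAB: "stable_set G S \<Longrightarrow> char_vec S \<in> STAB G"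
  by (simp add: STAB_def hull_inc)

text \<open>The converse half of Yannakakis' factorisation argument, in its combinatorial form: a facet
  \<open>F\<close> of an extension covers the pairs of an edge whose tight face lies in \<open>F\<close> and a stable set
  whose chosen preimage lies outside \<open>F\<close>.\<close>

theorem rectangle_cover_STAB:
  fixes G :: "nat pair_pre_digraph"
  assumes "pair_graph G"
  obtains \<U> where "finite \<U>" "card \<U> \<le> xc (STAB G)"
    "\<And>u v S. (u, v) \<in> parcs G \<Longrightarrow> stable_set G S \<Longrightarrow> u \<notin> S \<Longrightarrow> v \<notin> S
       \<Longrightarrow> \<exists>U\<in>\<U>. u \<in> U \<and> v \<in> U \<and> U \<inter> S = {}"
proof -
  interpret pair_graph G by fact
  have finS: "finite S" if "stable_set G S" for S
    using that pair_finite_verts by (auto simp: stable_set_def intro: finite_subset)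
  have "finite {S. stable_set G S}"
    using pair_finite_verts by (auto simp: stable_set_def)
  then have "polytope (STAB G)"
    unfolding polytope_def STAB_def by blast
  \<comment> \<open>\<open>STAB G\<close> is an extension of itself, so the minimum defining
    \<open>xc\<close> is attained.\<close>
  then have "polytope (STAB G) \<and> linear (\<lambda>x. x) \<and> (\<lambda>x. 0 + x) ` STAB G = STAB G \<and>
      card {F. facet F (STAB G)} = card {F. facet F (STAB G)}"
    by (simp add: linear_ident)
  then have "\<exists>k (Q :: (nat \<Rightarrow>\<^sub>0 real) set) f b. polytope Q \<and> linear f \<and>
      (\<lambda>x. b + f x) ` Q = STAB G \<and> card {F. facet F Q} = k"
    by blast
  then have "\<exists>(Q :: (nat \<Rightarrow>\<^sub>0 real) set) f b. polytope Q \<and> linear f \<and>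
      (\<lambda>x. b + f x) ` Q = STAB G \<and> card {F. facet F Q} = xc (STAB G)"
    unfolding xc_def by (rule LeastI_ex)
  then obtain Q :: "(nat \<Rightarrow>\<^sub>0 real) set" and f b where Q: "polytope Q" "linear f"
      "(\<lambda>x. b + f x) ` Q = STAB G" "card {F. facet F Q} = xc (STAB G)"
    by blast
  interpret f: linear f by fact
  obtain V where V: "finite V" "Q = convex hull V"
    using Q(1) unfolding polytope_def by blast
  define lift where "lift S = (SOME x. x \<in> Q \<and> b + f x = char_vec S)" for S
  have lift: "lift S \<in> Q" "b + f (lift S) = char_vec S" if "stable_set G S" for S
  proof -
    have "char_vec S \<in> (\<lambda>x. b + f x) ` Q"
      using that Q(3) by (simp add: char_vec_in_STAB)
    then have "\<exists>x. x \<in> Q \<and> b + f x = char_vec S" by auto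
    from someI_ex[OF this] show "lift S \<in> Q" "b + f (lift S) = char_vec S"
      unfolding lift_def by auto
  qed
  \<comment> \<open>The edge inequality pulled back to \<open>Q\<close>; the coordinates of the
    offset \<open>b\<close> move to the right-hand side \<open>\<beta> e\<close>.\<close>
  define g where "g e x = Poly_Mapping.lookup (f x) (fst e) + Poly_Mapping.lookup (f x) (snd e)"
    for e :: "nat \<times> nat" and x
  define \<beta> where "\<beta> e = 1 - Poly_Mapping.lookup b (fst e) - Poly_Mapping.lookup b (snd e)"
    for e :: "nat \<times> nat"
  define T where "T e = {x \<in> Q. g e x = \<beta> e}" for e
  define U where "U F = \<Union> {{fst e, snd e} | e. e \<in> parcs G \<and> T e \<subseteq> F}" for F
  have lin: "linear (g e)" for e
    by (rule linearI) (simp_all add: g_def f.add f.scale lookup_add lookup_scaleR algebra_simps)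
  have g_lift: "g (u, v) (lift S) = \<beta> (u, v) - 1 + (if u \<in> S then 1 else 0) + (if v \<in> S then 1 else 0)"
    if "stable_set G S" for u v S
  proof -
    have "f (lift S) = char_vec S - b"
      using lift(2)[OF that] by (simp add: algebra_simps)
    then show ?thesis
      by (simp add: g_def \<beta>_def lookup_minus lookup_char_vec finS[OF that])
  qed
  have le: "g e x \<le> \<beta> e" if e: "e \<in> parcs G" and x: "x \<in> Q" for e x
  proof -
    let ?h = "\<lambda>y :: nat \<Rightarrow>\<^sub>0 real. Poly_Mapping.lookup y (fst e) + Poly_Mapping.lookup y (snd e)"
    have "?h (b + f x) \<le> 1"
    proof (rule linear_le_on_convex_hull[where V = "char_vec ` {S. stable_set G S}"])
      show "linear ?h"
        by (rule linearI) (simp_all add: lookup_add lookup_scaleR algebra_simps)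
      show "b + f x \<in> convex hull char_vec ` {S. stable_set G S}"
        using x Q(3) by (auto simp: STAB_def)
      show "?h y \<le> 1" if "y \<in> char_vec ` {S. stable_set G S}" for y
        using that e finS by (cases e) (auto simp: lookup_char_vec stable_set_def)
    qed
    then show ?thesis by (simp add: g_def \<beta>_def lookup_add)
  qed
  show ?thesis
  proof (rule that)
    have fin: "finite {F. facet F Q}"
      using finite_faces_of_convex_hull[OF V(1)] V(2)
      by (auto simp: facet_def elim: rev_finite_subset)
    then show "finite (U ` {F. facet F Q})" by simp
    show "card (U ` {F. facet F Q}) \<le> xc (STAB G)"
      using card_image_le[OF fin] Q(4) by metis
    fix u v S assume uv: "(u, v) \<in> parcs G" and S: "stable_set G S" "u \<notin> S" "v \<notin> S"
    \<comment> \<open>The lift of \<open>{u}\<close> shows that the tight face is nonempty, as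
      \<open>facet_avoiding_point\<close> requires.\<close>
    have "\<exists>x\<in>Q. g (u, v) x = \<beta> (u, v)"
    proof -
      have u: "stable_set G {u}"
        using uv no_loops' by (auto simp: stable_set_def dest: in_arcsD1)
      have "u \<noteq> v" using uv no_loops' by blast
      then show ?thesis
        using lift(1)[OF u] g_lift[OF u, of u v] by auto
    qed
    then obtain F where F: "facet F Q" "T (u, v) \<subseteq> F" "lift S \<notin> F"
      using facet_avoiding_point[OF V(1) lin, of "(u, v)" "\<beta> (u, v)" "lift S"] V(2)
        le[OF uv] lift(1)[OF S(1)] g_lift[OF S(1), of u v] S hull_inc[of _ V convex]
      by (auto simp: T_def)
    \<comment> \<open>By stability an edge meeting \<open>S\<close> has exactly one end there, so
      \<open>lift S\<close> is tight for it and the tight face cannot lie in \<open>F\<close>, which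
      avoids \<open>lift S\<close>.\<close>
    have "U F \<inter> S = {}"
    proof (rule ccontr)
      assume "U F \<inter> S \<noteq> {}"
      then obtain e where e: "e \<in> parcs G" "T e \<subseteq> F" "fst e \<in> S \<or> snd e \<in> S"
        unfolding U_def by blast
      obtain x y where xy: "e = (x, y)" by (cases e)
      then have "\<not> (x \<in> S \<and> y \<in> S)" using e S(1) by (auto simp: stable_set_def)
      then have "g e (lift S) = \<beta> e"
        using e(3) g_lift[OF S(1), of x y] xy by auto
      then have "lift S \<in> T e" using lift(1)[OF S(1)] by (simp add: T_def)
      with e F show False by blast
    qed
    moreover have "{u, v} \<subseteq> U F"
      unfolding U_def using uv F(2) by (intro Union_upper CollectI exI[of _ "(u, v)"]) simp
    ultimately show "\<exists>W\<in>U ` {F. facet F Q}. u \<in> W \<and> v \<in> W \<and> W \<inter> S = {}"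
      using F(1) by auto
  qed
qed

section \<open>Rectangle covers of partial linear spaces\<close>

text \<open>The power is the probability that \<open>y\<close> given lines stay unselected. It is at
  most \<open>exp (- y / k)\<close>, and \<open>y / k \<le> exp (y / k)\<close>.\<close>

lemma mult_power_le:
  assumes "k \<ge> 1"
  shows "real y * (1 - 1 / real k) ^ y \<le> real k"
proof -
  have "(1 - 1 / real k) ^ y \<le> exp (- 1 / real k) ^ y"
    using assms exp_ge_add_one_self[of "- 1 / real k"] by (intro power_mono) auto
  also have "\<dots> = exp (- real y / real k)"
    by (simp add: exp_of_nat_mult[symmetric])
  finally have "real y * (1 - 1 / real k) ^ y \<le> real y * exp (- real y / real k)"
    by (intro mult_left_mono) auto
  also have "real y \<le> real k * exp (real y / real k)"
    using assms exp_ge_add_one_self[of "real y / real k"] by (simp add: field_simps)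
  then have "real y * exp (- real y / real k) \<le> real k * exp (real y / real k) * exp (- real y / real k)"
    by (intro mult_right_mono) auto
  also have "\<dots> = real k"
    by (simp add: mult.assoc exp_add[symmetric])
  finally show ?thesis .
qed

text \<open>Incidence is given from the side of the points: \<open>N p\<close> is the pencil of
  lines through \<open>p\<close>.\<close>

locale partial_linear_space =
  fixes P :: "'p set" and L :: "'l set" and N :: "'p \<Rightarrow> 'l set" and d :: nat
  assumes finite_P: "finite P" and finite_L: "finite L"
    and N_sub: "p \<in> P \<Longrightarrow> N p \<subseteq> L"
    and card_N: "p \<in> P \<Longrightarrow> card (N p) = d"
    and card_N_Int: "p \<in> P \<Longrightarrow> q \<in> P \<Longrightarrow> p \<noteq> q \<Longrightarrow> card (N p \<inter> N q) \<le> 1"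
begin

definition flags :: "'p set \<Rightarrow> 'l set \<Rightarrow> ('p \<times> 'l) set" where
  "flags X Y = (SIGMA p:X. N p \<inter> Y)"

text \<open>A uniformly random \<open>f\<close> selects each line independently with probability \<open>1/k\<close>, namely when
  \<open>f l = 0\<close>. The event is that no line of \<open>T\<close> is selected, but some line through each point of
  \<open>X\<close> is.\<close>

definition colourings :: "nat \<Rightarrow> 'l set \<Rightarrow> 'p set \<Rightarrow> ('l \<Rightarrow> nat) set" where
  "colourings k T X =
    {f \<in> L \<rightarrow>\<^sub>E {..<k}. (\<forall>l\<in>T. f l \<noteq> 0) \<and> (\<forall>p\<in>X. \<exists>l\<in>N p. f l = 0)}"

definition pr :: "nat \<Rightarrow> 'l set \<Rightarrow> 'p set \<Rightarrow> real" where
  "pr k T X = real (card (colourings k T X)) / real k ^ card L"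

section \<open>Probabilities of avoiding lines and hitting points\<close>

lemma finite_N: "p \<in> P \<Longrightarrow> finite (N p)"
  using N_sub finite_L by (blast intro: finite_subset)

lemma finite_colourings: "finite (colourings k T X)"
  by (rule finite_subset[OF _ finite_PiE[OF finite_L, of "\<lambda>_. {..<k}"]]) (auto simp: colourings_def)

lemma pr_mono: "colourings k T X \<subseteq> colourings k T' X' \<Longrightarrow> pr k T X \<le> pr k T' X'"
  unfolding pr_def by (intro divide_right_mono) (auto simp: finite_colourings card_mono)

lemma pr_nonneg: "pr k T X \<ge> 0"
  by (simp add: pr_def)

lemma pr_empty:
  assumes T: "T \<subseteq> L" and k: "k \<ge> 1"
  shows "pr k T {} = (1 - 1 / real k) ^ card T"
proof -
  have "colourings k T {} = PiE L (\<lambda>l. if l \<in> T then {1..<k} else {..<k})"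
    using T by (auto simp: colourings_def PiE_iff extensional_def Suc_le_eq split: if_splits)
  then have "card (colourings k T {}) = (\<Prod>l\<in>L. if l \<in> T then k - 1 else k)"
    using finite_L by (auto simp: card_PiE intro!: prod.cong)
  also have "\<dots> = (k - 1) ^ card T * k ^ card (L - T)"
    using finite_L T by (simp add: prod.If_cases Int_absorb1 Diff_eq)
  finally have "pr k T {} = (real k - 1) ^ card T * real k ^ card (L - T) / real k ^ card L"
    using k by (simp add: pr_def of_nat_diff)
  also have "card L = card T + card (L - T)"
    using finite_L T by (metis card_Diff_subset card_mono finite_subset le_add_diff_inverse)
  also have "(real k - 1) ^ card T * real k ^ card (L - T) / real k ^ (card T + card (L - T)) =
      ((real k - 1) / real k) ^ card T"
    using k by (simp add: power_add power_divide)
  finally show ?thesis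
    using k by (simp add: diff_divide_distrib)
qed

text \<open>Missing \<open>p\<close> means that no line of \<open>N p\<close> is selected, so the
  complementary event merely enlarges the avoided set.\<close>

lemma pr_insert: "pr k T (insert p X) = pr k T X - pr k (T \<union> N p) X"
proof -
  let ?A = "colourings k T X" and ?Q = "\<lambda>f. \<exists>l\<in>N p. f l = 0"
  have "colourings k T (insert p X) = {f \<in> ?A. ?Q f}"
    "colourings k (T \<union> N p) X = {f \<in> ?A. \<not> ?Q f}"
    by (auto simp: colourings_def)
  moreover have "card ?A = card {f \<in> ?A. ?Q f} + card {f \<in> ?A. \<not> ?Q f}"
    using finite_colourings by (subst card_Un_disjoint[symmetric]) (auto intro: arg_cong[where f = card])
  ultimately show ?thesis
    by (simp add: pr_def diff_divide_distrib[symmetric])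
qed

text \<open>Outside \<open>T\<close> the pencils are disjoint, so the points of \<open>X\<close> are
  hit independently. In the induction, adding \<open>N p\<close> to \<open>T\<close> leaves
  \<open>N q - T\<close> unchanged for the other points \<open>q\<close>.\<close>

lemma pr_eq:
  assumes "finite X" "X \<subseteq> P" "T \<subseteq> L" "k \<ge> 1"
    and "\<And>p q. p \<in> X \<Longrightarrow> q \<in> X \<Longrightarrow> p \<noteq> q \<Longrightarrow> N p \<inter> N q \<subseteq> T"
  shows "pr k T X = (1 - 1 / real k) ^ card T * (\<Prod>p\<in>X. 1 - (1 - 1 / real k) ^ card (N p - T))"
  using assms
proof (induction X arbitrary: T rule: finite_induct)
  case empty
  then show ?case by (simp add: pr_empty)
next
  case (insert p X)
  let ?s = "1 - 1 / real k"
  have p: "N p \<subseteq> L" using insert N_sub by auto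
  have "card (T \<union> N p) = card T + card (N p - T)"
    using card_Un_disjoint[of T "N p - T"] finite_subset[OF p finite_L]
      finite_subset[OF insert.prems(2) finite_L] by auto
  moreover have "N q - (T \<union> N p) = N q - T" if "q \<in> X" for q
    using insert.prems(4)[of q p] insert.hyps(2) that by auto
  moreover have "pr k (T \<union> N p) X =
      ?s ^ card (T \<union> N p) * (\<Prod>q\<in>X. 1 - ?s ^ card (N q - (T \<union> N p)))"
    using insert.prems p by (intro insert.IH) auto
  moreover have "pr k T X = ?s ^ card T * (\<Prod>q\<in>X. 1 - ?s ^ card (N q - T))"
    using insert.prems by (intro insert.IH) auto
  ultimately show ?case
    using insert.hyps by (simp add: pr_insert power_add algebra_simps)
qed

lemma pr_le:
  assumes X: "X \<subseteq> P" and T: "T \<subseteq> L" and k: "k \<ge> 1"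
    and "\<And>p q. p \<in> X \<Longrightarrow> q \<in> X \<Longrightarrow> p \<noteq> q \<Longrightarrow> N p \<inter> N q \<subseteq> T"
  shows "pr k T X \<le> (1 - 1 / real k) ^ card T * (1 - (1 - 1 / real k) ^ d) ^ card X"
proof -
  let ?s = "1 - 1 / real k"
  have s: "0 \<le> ?s" "?s \<le> 1" using k by auto
  have finX: "finite X" using X finite_P finite_subset by blast
  have "(\<Prod>p\<in>X. 1 - ?s ^ card (N p - T)) \<le> (\<Prod>p\<in>X. 1 - ?s ^ d)"
  proof (rule prod_mono)
    fix p assume p: "p \<in> X"
    then have "card (N p - T) \<le> d"
      using X card_N[of p] finite_N[of p] by (metis Diff_subset card_mono subsetD)
    then have "?s ^ d \<le> ?s ^ card (N p - T)"
      using s by (intro power_decreasing) auto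
    then show "0 \<le> 1 - ?s ^ card (N p - T) \<and> 1 - ?s ^ card (N p - T) \<le> 1 - ?s ^ d"
      using s by (auto intro: power_le_one)
  qed
  then show ?thesis
    using pr_eq[OF finX assms] s by (simp add: mult_left_mono)
qed

section \<open>Counting flags\<close>

lemma card_flags: "X \<subseteq> P \<Longrightarrow> card (flags X Y) = (\<Sum>p\<in>X. card (N p \<inter> Y))"
  unfolding flags_def using finite_P finite_N by (intro card_SigmaI) (auto intro: finite_subset)

lemma finite_flags: "X \<subseteq> P \<Longrightarrow> finite (flags X Y)"
  unfolding flags_def using finite_P finite_N by (intro finite_SigmaI) (auto intro: finite_subset)

lemma card_flags_P_L: "card (flags P L) = card P * d"
proof -
  have "card (flags P L) = (\<Sum>p\<in>P. d)"
    unfolding card_flags[OF subset_refl]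
    by (intro sum.cong) (auto simp: Int_absorb2[OF N_sub] card_N)
  then show ?thesis by simp
qed

lemma card_flags_swap:
  assumes X: "X \<subseteq> P" and Y: "Y \<subseteq> L"
  shows "card (flags X Y) = (\<Sum>l\<in>Y. card {p \<in> X. l \<in> N p})"
proof -
  have fin: "finite X" "finite Y" using assms finite_P finite_L finite_subset by blast+
  have "card (flags X Y) = (\<Sum>p\<in>X. \<Sum>l\<in>Y. if l \<in> N p then 1 else 0)"
    using fin by (auto simp: card_flags[OF X] sum.If_cases Int_commute Int_def intro!: sum.cong arg_cong[where f=card])
  also have "\<dots> = (\<Sum>l\<in>Y. \<Sum>p\<in>X. if l \<in> N p then 1 else 0)"
    by (rule sum.swap)
  also have "\<dots> = (\<Sum>l\<in>Y. card {p \<in> X. l \<in> N p})"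
    using fin by (auto simp: sum.If_cases Int_def intro!: sum.cong arg_cong[where f=card])
  finally show ?thesis .
qed

text \<open>Points of \<open>X\<close> are added one by one. Flags on lines not met before number at
  most \<open>card Y\<close> in total, and a new point shares at most one line with each earlier
  point.\<close>

lemma card_flags_le:
  assumes "X \<subseteq> P" "Y \<subseteq> L"
  shows "card (flags X Y) \<le> card Y + card X * card X"
proof -
  have finY: "finite Y" using assms finite_L finite_subset by blast
  have "finite X" using assms finite_P finite_subset by blast
  then have "card (flags X Y) \<le> card ((\<Union>p\<in>X. N p) \<inter> Y) + card X * card X"
    using assms(1)
  proof (induction X rule: finite_induct)
    case empty
    then show ?case by (simp add: flags_def)
  next
    case (insert p X)
    let ?U = "\<Union>q\<in>X. N q"
    have "card (N p \<inter> Y) \<le> card (N p \<inter> Y - ?U) + card (\<Union>q\<in>X. N p \<inter> N q)"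
    proof -
      have "card (N p \<inter> Y) \<le> card ((N p \<inter> Y - ?U) \<union> (\<Union>q\<in>X. N p \<inter> N q))"
        using insert finite_N by (intro card_mono) auto
      then show ?thesis using card_Un_le order_trans by blast
    qed
    moreover have "card (\<Union>q\<in>X. N p \<inter> N q) \<le> (\<Sum>q\<in>X. card (N p \<inter> N q))"
      using insert.hyps(1) by (rule card_UN_le)
    moreover have "(\<Sum>q\<in>X. card (N p \<inter> N q)) \<le> (\<Sum>q\<in>X. 1)"
      using insert by (intro sum_mono card_N_Int) auto
    moreover have "card ((\<Union>q\<in>insert p X. N q) \<inter> Y) = card (N p \<inter> Y - ?U) + card (?U \<inter> Y)"
      using finY by (subst card_Un_disjoint[symmetric]) (auto intro!: arg_cong[where f=card])
    moreover have "card (flags (insert p X) Y) = card (N p \<inter> Y) + card (flags X Y)"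
      using insert by (simp add: card_flags)
    ultimately show ?case
      using insert by simp
  qed
  also have "card ((\<Union>p\<in>X. N p) \<inter> Y) \<le> card Y"
    using finY by (intro card_mono) auto
  finally show ?thesis by simp
qed

text \<open>Either some line with two or more points of \<open>X\<close> is selected, or every point of \<open>X\<close> is hit
  by a line containing no other point of \<open>X\<close>, and these events are independent.\<close>

lemma pr_le_sample:
  assumes X: "X \<subseteq> P" and Y: "Y \<subseteq> L" and k: "k \<ge> 1"
  shows "pr k Y X \<le> (1 - 1 / real k) ^ card Y *
    (real (card X) ^ 2 / real k + (1 - (1 - 1 / real k) ^ d) ^ card X)"
proof -
  let ?s = "1 - 1 / real k"
  have s: "0 \<le> ?s" "?s \<le> 1" using k by auto
  have sd: "0 \<le> 1 - ?s ^ d" using s by (auto intro: power_le_one)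
  have finX: "finite X" using X finite_P finite_subset by blast
  have finY: "finite Y" using Y finite_L finite_subset by blast
  \<comment> \<open>The lines carrying at least two points of \<open>X\<close>, at most one for each
    ordered pair.\<close>
  define T where "T = (\<Union>(p, q)\<in>{(p, q) \<in> X \<times> X. p \<noteq> q}. N p \<inter> N q)"
  have T: "T \<subseteq> L" using X N_sub by (auto simp: T_def)
  then have finT: "finite T" using finite_L finite_subset by blast
  have "card T \<le> (\<Sum>(p, q)\<in>{(p, q) \<in> X \<times> X. p \<noteq> q}. card (N p \<inter> N q))"
    unfolding T_def using finX
    by (intro order_trans[OF card_UN_le] sum_mono) (auto intro: finite_subset[of _ "X \<times> X"])
  also have "\<dots> \<le> (\<Sum>(p, q)\<in>{(p, q) \<in> X \<times> X. p \<noteq> q}. 1)"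
    using X by (intro sum_mono) (auto intro: card_N_Int[unfolded One_nat_def])
  also have "\<dots> = card {(p, q) \<in> X \<times> X. p \<noteq> q}" by (simp add: case_prod_unfold)
  also have "\<dots> \<le> card (X \<times> X)" using finX by (intro card_mono) auto
  finally have cardT: "card T \<le> card X ^ 2" by (simp add: power2_eq_square card_cartesian_product)
  define A where "A l = colourings k Y {} - colourings k (insert l Y) {}" for l
  have "real (card (A l)) / real k ^ card L = ?s ^ card Y / real k" if "l \<in> T - Y" for l
  proof -
    have "colourings k (insert l Y) {} \<subseteq> colourings k Y {}"
      by (auto simp: colourings_def)
    then have "real (card (A l)) / real k ^ card L = pr k Y {} - pr k (insert l Y) {}"
      unfolding A_def pr_def using finite_colourings
      by (simp add: card_Diff_subset of_nat_diff card_mono diff_divide_distrib)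
    also have "\<dots> = ?s ^ card Y - ?s ^ Suc (card Y)"
      using that T Y k finY by (subst (1 2) pr_empty) auto
    finally show ?thesis by (simp add: algebra_simps)
  qed
  then have A: "real (card (A l)) = real k ^ card L * (?s ^ card Y / real k)" if "l \<in> T - Y" for l
    using that k by (simp add: field_simps)
  \<comment> \<open>If no line of \<open>T\<close> is selected, then \<open>T\<close> joins the
    avoided set, outside which the pencils of points in \<open>X\<close> are disjoint.\<close>
  have "colourings k Y X \<subseteq> (\<Union>l\<in>T - Y. A l) \<union> colourings k (Y \<union> T) X"
    by (auto simp: colourings_def A_def)
  then have "card (colourings k Y X) \<le> card ((\<Union>l\<in>T - Y. A l) \<union> colourings k (Y \<union> T) X)"
    using finT finite_colourings by (intro card_mono) (auto simp: A_def)
  also have "\<dots> \<le> (\<Sum>l\<in>T - Y. card (A l)) + card (colourings k (Y \<union> T) X)"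
    using finT by (intro order_trans[OF card_Un_le] add_right_mono card_UN_le) auto
  finally have "real (card (colourings k Y X)) \<le>
      (\<Sum>l\<in>T - Y. real (card (A l))) + real (card (colourings k (Y \<union> T) X))"
    unfolding of_nat_sum[symmetric] of_nat_add[symmetric] of_nat_le_iff .
  also have "(\<Sum>l\<in>T - Y. real (card (A l))) = real (card (T - Y)) * (real k ^ card L * (?s ^ card Y / real k))"
    using A by simp
  also have "\<dots> \<le> real (card X) ^ 2 * (real k ^ card L * (?s ^ card Y / real k))"
  proof (intro mult_right_mono)
    have "card (T - Y) \<le> card X ^ 2"
      using cardT finT card_mono[of T "T - Y"] by auto
    then show "real (card (T - Y)) \<le> (real (card X))\<^sup>2"
      by (metis of_nat_le_iff of_nat_power)
  qed (use s in auto)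
  finally have "pr k Y X \<le> ?s ^ card Y * (real (card X) ^ 2 / real k) + pr k (Y \<union> T) X"
    unfolding pr_def using k by (simp add: field_simps)
  also have "pr k (Y \<union> T) X \<le> ?s ^ card (Y \<union> T) * (1 - ?s ^ d) ^ card X"
    using X Y T k by (intro pr_le) (auto simp: T_def)
  also have "\<dots> \<le> ?s ^ card Y * (1 - ?s ^ d) ^ card X"
    using s sd finY finT by (intro mult_right_mono power_decreasing card_mono) auto
  finally show ?thesis by (simp add: distrib_left)
qed

section \<open>Weight of a rectangle and size of a cover\<close>

text \<open>The left-hand side is the expected number of flags covered by the rectangle. If a line
  of \<open>Y\<close> holds \<open>r\<close> points of \<open>X\<close>, hitting them all has
  probability at most \<open>\<sigma>\<close>, and bounding the flags by all of them suffices. If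
  \<open>X\<close> is small, there are at most \<open>card Y + k\<close> flags. Otherwise there are
  at most \<open>r * card Y\<close>, and \<open>pr_le_sample\<close> is applied to \<open>r\<close>
  points of \<open>X\<close>.\<close>

lemma rectangle_weight_le:
  assumes X: "X \<subseteq> P" and Y: "Y \<subseteq> L" and k: "k \<ge> 1" and r: "r ^ 3 \<le> k"
    and \<sigma>: "\<sigma> = (1 - (1 - 1 / real k) ^ d) ^ r"
    and \<sigma>1: "real r * \<sigma> \<le> 1" and \<sigma>2: "real (card P * d) * \<sigma> \<le> 2 * real k"
  shows "real (card (flags X Y)) * pr k Y X \<le> 2 * real k"
proof -
  let ?s = "1 - 1 / real k"
  have s: "0 \<le> ?s" "?s \<le> 1" using k by auto
  have sY: "0 \<le> ?s ^ card Y" "?s ^ card Y \<le> 1" using s by (auto intro: power_le_one)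
  have \<sigma>0: "0 \<le> \<sigma>" unfolding \<sigma> using s by (auto intro!: zero_le_power power_le_one)
  have finX: "finite X" using X finite_P finite_subset by blast
  have prY: "pr k Y X \<le> ?s ^ card Y"
    using pr_mono[of k Y X Y "{}"] pr_empty[OF Y k] by (auto simp: colourings_def)
  consider (rich) l where "l \<in> Y" "r \<le> card {p \<in> X. l \<in> N p}"
    | (small) "card X < r"
    | (generic) "r \<le> card X" "\<And>l. l \<in> Y \<Longrightarrow> card {p \<in> X. l \<in> N p} \<le> r"
    by force
  then show ?thesis
  proof cases
    case rich
    obtain Z where Z: "Z \<subseteq> {p \<in> X. l \<in> N p}" "card Z = r"
      using rich(2) obtain_subset_with_card_n by metis
    \<comment> \<open>The only common line of two points of \<open>Z\<close> is \<open>l\<close>,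
      which is already avoided, so the points of \<open>Z\<close> are hit independently.\<close>
    have "N p \<inter> N q \<subseteq> Y" if "p \<in> Z" "q \<in> Z" "p \<noteq> q" for p q
    proof -
      have "card (N p \<inter> N q) \<le> 1" "l \<in> N p \<inter> N q" "finite (N p \<inter> N q)"
        using that Z X card_N_Int[of p q] finite_N by auto
      then show ?thesis using rich(1)
        by (metis card_le_Suc0_iff_eq One_nat_def subsetI)
    qed
    then have "pr k Y Z \<le> ?s ^ card Y * \<sigma>"
      unfolding \<sigma> Z(2)[symmetric] using Z X Y k by (intro pr_le) auto
    moreover have "pr k Y X \<le> pr k Y Z"
      using Z by (intro pr_mono) (auto simp: colourings_def)
    moreover have "?s ^ card Y * \<sigma> \<le> 1 * \<sigma>"
      using sY \<sigma>0 by (intro mult_right_mono) auto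
    ultimately have "pr k Y X \<le> \<sigma>" by simp
    moreover have "card (flags X Y) \<le> card P * d"
      unfolding card_flags_P_L[symmetric]
      using X Y by (intro card_mono finite_flags) (auto simp: flags_def)
    ultimately have "real (card (flags X Y)) * pr k Y X \<le> real (card P * d) * \<sigma>"
      using pr_nonneg by (intro mult_mono) (auto simp del: of_nat_mult)
    with \<sigma>2 show ?thesis by linarith
  next
    case small
    have "card X * card X \<le> r * r" using small by (intro mult_mono) auto
    also have "\<dots> \<le> r ^ 3" using small by (cases r) (auto simp: power3_eq_cube)
    finally have "real (card X * card X) \<le> real k" using r by linarith
    moreover have "real (card (flags X Y)) \<le> real (card Y) + real (card X * card X)"
      using card_flags_le[OF X Y] by linarith
    ultimately have "real (card (flags X Y)) \<le> real (card Y) + real k" by linarith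
    then have "real (card (flags X Y)) * pr k Y X \<le> (real (card Y) + real k) * ?s ^ card Y"
      using prY pr_nonneg by (intro mult_mono) auto
    also have "\<dots> = real (card Y) * ?s ^ card Y + real k * ?s ^ card Y"
      by (simp add: distrib_right)
    also have "\<dots> \<le> real k + real k * 1"
      using sY by (intro add_mono mult_power_le k mult_left_mono) auto
    finally show ?thesis by simp
  next
    case generic
    obtain Z where Z: "Z \<subseteq> X" "card Z = r"
      using generic(1) obtain_subset_with_card_n by metis
    have "pr k Y X \<le> pr k Y Z"
      using Z by (intro pr_mono) (auto simp: colourings_def)
    also have "\<dots> \<le> ?s ^ card Y * (real r ^ 2 / real k + \<sigma>)"
      unfolding \<sigma> Z(2)[symmetric] using Z X Y k by (intro pr_le_sample) auto
    finally have pr: "pr k Y X \<le> ?s ^ card Y * (real r ^ 2 / real k + \<sigma>)" .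
    have "card (flags X Y) \<le> (\<Sum>l\<in>Y. r)"
      unfolding card_flags_swap[OF X Y] using generic(2) by (rule sum_mono)
    then have "real (card (flags X Y)) \<le> real (card Y) * real r"
      by (simp flip: of_nat_mult)
    then have "real (card (flags X Y)) * pr k Y X \<le>
        real (card Y) * real r * (?s ^ card Y * (real r ^ 2 / real k + \<sigma>))"
      using pr pr_nonneg by (intro mult_mono) auto
    also have "\<dots> = real (card Y) * ?s ^ card Y * (real r * (real r ^ 2 / real k + \<sigma>))"
      by simp
    also have "\<dots> \<le> real k * (real r * (real r ^ 2 / real k + \<sigma>))"
      using \<sigma>0 by (intro mult_right_mono mult_power_le k) auto
    also have "\<dots> = real (r ^ 3) + real k * (real r * \<sigma>)"
      using k by (simp add: algebra_simps power2_eq_square power3_eq_cube)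
    also have "\<dots> \<le> real k + real k * 1"
      using r \<sigma>1 by (intro add_mono mult_left_mono) auto
    finally show ?thesis by simp
  qed
qed

text \<open>Count the pairs of a flag and a selection disjoint from it: each flag has at least a
  quarter of all selections, and each rectangle accounts for at most \<open>2 * k\<close> times the
  number of selections. This gives the factor 8.\<close>

lemma card_rectangle_cover_ge:
  assumes k: "k \<ge> 2" and d: "d > k" and r: "r ^ 3 \<le> k"
    and \<sigma>: "\<sigma> = (1 - (1 - 1 / real k) ^ d) ^ r"
    and \<sigma>1: "real r * \<sigma> \<le> 1" and \<sigma>2: "real (card P * d) * \<sigma> \<le> 2 * real k"
    and fin: "finite \<R>" and sub: "\<And>X Y. (X, Y) \<in> \<R> \<Longrightarrow> X \<subseteq> P \<and> Y \<subseteq> L"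
    and cover: "\<And>p l f. p \<in> P \<Longrightarrow> l \<in> N p \<Longrightarrow> f \<in> colourings k {l} {p} \<Longrightarrow>
      \<exists>(X, Y)\<in>\<R>. p \<in> X \<and> l \<in> Y \<and> f \<in> colourings k Y X"
  shows "real (card P * d) \<le> 8 * real k * real (card \<R>)"
proof -
  let ?s = "1 - 1 / real k"
  have s: "1/2 \<le> ?s" "0 \<le> ?s" "?s \<le> 1" using k by auto
  have k1: "k \<ge> 1" using k by simp
  \<comment> \<open>Since \<open>d - 1\<close> is at least \<open>k\<close>, the power is at most
    \<open>exp (- 1)\<close>.\<close>
  have sd: "?s ^ (d - 1) \<le> 1/2"
  proof -
    have "?s ^ (d - 1) \<le> ?s ^ k" using s d by (intro power_decreasing) auto
    also have "\<dots> \<le> exp (- 1 / real k) ^ k"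
      using s exp_ge_add_one_self[of "- 1 / real k"] by (intro power_mono) auto
    also have "\<dots> = exp (- 1)" using k by (simp add: exp_of_nat_mult[symmetric])
    also have "\<dots> \<le> 1/2"
      using exp_ge_add_one_self[of 1] by (simp add: exp_minus field_simps)
    finally show ?thesis .
  qed
  define A where "A = (SIGMA (p, l) : flags P L. colourings k {l} {p})"
  have flag: "real (card (colourings k {l} {p})) \<ge> real k ^ card L / 4" if "(p, l) \<in> flags P L" for p l
  proof -
    have pl: "p \<in> P" "l \<in> N p" "l \<in> L" using that by (auto simp: flags_def)
    \<comment> \<open>The line \<open>l\<close> must stay unselected, so \<open>p\<close> has to be
      hit by one of its \<open>d - 1\<close> other lines.\<close>
    have "pr k {l} {p} = ?s * (1 - ?s ^ (d - 1))"
      using pr_eq[of "{p}" "{l}" k] pl k1 card_N[of p] finite_N[of p] by simp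
    also have "\<dots> \<ge> (1/2) * (1/2)"
      using s sd by (intro mult_mono) auto
    finally show ?thesis using k by (simp add: pr_def field_simps)
  qed
  have "real (card P * d) * (real k ^ card L / 4) = (\<Sum>(p, l)\<in>flags P L. real k ^ card L / 4)"
    by (simp add: card_flags_P_L case_prod_unfold)
  also have "\<dots> \<le> (\<Sum>(p, l)\<in>flags P L. real (card (colourings k {l} {p})))"
    using flag by (intro sum_mono) auto
  also have "\<dots> = real (card A)"
    unfolding A_def using finite_flags[of P L] finite_colourings
    by (subst card_SigmaI) (auto simp: case_prod_unfold)
  also have "\<dots> \<le> real (card (\<Union>(X, Y)\<in>\<R>. flags X Y \<times> colourings k Y X))"
  proof (intro of_nat_mono card_mono)
    show "finite (\<Union>(X, Y)\<in>\<R>. flags X Y \<times> colourings k Y X)"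
      using fin sub finite_flags finite_colourings by auto
    show "A \<subseteq> (\<Union>(X, Y)\<in>\<R>. flags X Y \<times> colourings k Y X)"
    proof
      fix a assume "a \<in> A"
      then obtain p l f where a: "a = ((p, l), f)" "p \<in> P" "l \<in> N p" "f \<in> colourings k {l} {p}"
        by (auto simp: A_def flags_def)
      then show "a \<in> (\<Union>(X, Y)\<in>\<R>. flags X Y \<times> colourings k Y X)"
        using cover[OF a(2-4)] by (auto simp: flags_def)
    qed
  qed
  also have "\<dots> \<le> real (\<Sum>(X, Y)\<in>\<R>. card (flags X Y \<times> colourings k Y X))"
    using card_UN_le[OF fin, of "\<lambda>(X, Y). flags X Y \<times> colourings k Y X"]
    by (simp add: case_prod_unfold del: of_nat_sum)
  also have "\<dots> = (\<Sum>(X, Y)\<in>\<R>. real (card (flags X Y)) * real (card (colourings k Y X)))"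
    by (simp add: case_prod_unfold card_cartesian_product)
  also have "\<dots> \<le> (\<Sum>(X, Y)\<in>\<R>. 2 * real k * real k ^ card L)"
  proof (rule sum_mono, clarify)
    fix X Y assume XY: "(X, Y) \<in> \<R>"
    have "real (card (flags X Y)) * pr k Y X \<le> 2 * real k"
      using sub[OF XY] by (intro rectangle_weight_le[OF _ _ k1 r \<sigma> \<sigma>1 \<sigma>2]) auto
    then show "real (card (flags X Y)) * real (card (colourings k Y X)) \<le> 2 * real k * real k ^ card L"
      using k by (simp add: pr_def field_simps)
  qed
  finally have "real (card P * d) * (real k ^ card L / 4) \<le> real (card \<R>) * (2 * real k * real k ^ card L)"
    by (simp add: case_prod_unfold)
  then have "(real (card P * d) / 4) * real k ^ card L \<le> (real (card \<R>) * (2 * real k)) * real k ^ card L"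
    by (simp add: algebra_simps)
  then have "real (card P * d) / 4 \<le> real (card \<R>) * (2 * real k)"
    by (rule mult_right_le_imp_le) (use k in simp)
  then show ?thesis by (simp add: algebra_simps)
qed

end

section \<open>The incidence graphs\<close>

text \<open>A \<open>q\<close> by \<open>q^2\<close> grid with lines of small integer slope, which
  works for every \<open>q\<close>, not only prime powers.\<close>

definition points :: "nat \<Rightarrow> (nat \<times> nat) set" where
  "points q = {..<q} \<times> {..<q^2}"

definition lines :: "nat \<Rightarrow> (nat \<times> nat) set" where
  "lines q = {..<q} \<times> {..<2 * q^2}"

text \<open>The pair \<open>(a, b)\<close> is the line with slope \<open>a\<close> and intercept \<open>b - q\<^sup>2\<close>; the shift makes every
  point lie on exactly one line of each slope \<open>a < q\<close>.\<close>

definition through :: "nat \<Rightarrow> nat \<times> nat \<Rightarrow> (nat \<times> nat) set" where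
  "through q p = {(a, b) \<in> lines q. a * fst p + b = snd p + q^2}"

text \<open>Points and lines are coded as distinct natural numbers, so that all graphs of the class
  share one vertex type.\<close>

definition point_vertex :: "nat \<times> nat \<Rightarrow> nat" where
  "point_vertex p = sum_encode (Inl (prod_encode p))"

definition line_vertex :: "nat \<times> nat \<Rightarrow> nat" where
  "line_vertex l = sum_encode (Inr (prod_encode l))"

definition incidence_graph :: "nat \<Rightarrow> nat pair_pre_digraph" where
  "incidence_graph q = \<lparr>pverts = point_vertex ` points q \<union> line_vertex ` lines q,
    parcs = {(point_vertex p, line_vertex l) | p l. p \<in> points q \<and> l \<in> through q p} \<union>
      {(line_vertex l, point_vertex p) | p l. p \<in> points q \<and> l \<in> through q p}\<rparr>"

lemma vertex_simps [simp]:
  "point_vertex p = point_vertex p' \<longleftrightarrow> p = p'"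
  "line_vertex l = line_vertex l' \<longleftrightarrow> l = l'"
  "point_vertex p \<noteq> line_vertex l" "line_vertex l \<noteq> point_vertex p"
  by (auto simp: point_vertex_def line_vertex_def sum_encode_eq prod_encode_eq)

lemma card_points: "card (points q) = q^3"
  by (simp add: points_def card_cartesian_product power2_eq_square power3_eq_cube)

lemma card_lines: "card (lines q) = 2 * q^3"
  by (simp add: lines_def card_cartesian_product power2_eq_square power3_eq_cube)

lemma card_through:
  assumes "p \<in> points q"
  shows "card (through q p) = q"
proof -
  obtain x y where p: "p = (x, y)" "x < q" "y < q^2"
    using assms by (auto simp: points_def)
  have ax: "a * x \<le> q^2" if "a < q" for a
    using that p by (auto simp: power2_eq_square intro: mult_mono)
  have "through q p = (\<lambda>a. (a, y + q^2 - a * x)) ` {..<q}"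
  proof (rule set_eqI, clarify)
    fix a b
    show "(a, b) \<in> through q p \<longleftrightarrow> (a, b) \<in> (\<lambda>a. (a, y + q^2 - a * x)) ` {..<q}"
      using ax[of a] p by (auto simp: through_def lines_def image_iff)
  qed
  moreover have "inj_on (\<lambda>a. (a, y + q^2 - a * x)) {..<q}"
    by (auto simp: inj_on_def)
  ultimately show ?thesis by (simp add: card_image)
qed

text \<open>Two points on a common line have different abscissae, and subtracting the equations of
  two common lines makes \<open>(a - a') * (x - x')\<close> vanish, so the slopes agree.\<close>

lemma through_Int:
  assumes "p \<noteq> p'" "l \<in> through q p \<inter> through q p'" "l' \<in> through q p \<inter> through q p'"
  shows "l = l'"
proof -
  obtain x y x' y' a b a' b' where [simp]: "p = (x, y)" "p' = (x', y')" "l = (a, b)" "l' = (a', b')"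
    by (metis prod.exhaust)
  have eq: "a * x + b = y + q^2" "a * x' + b = y' + q^2" "a' * x + b' = y + q^2" "a' * x' + b' = y' + q^2"
    using assms by (auto simp: through_def)
  have "x \<noteq> x'" using eq assms(1) by auto
  have "int a * int x + int b = int y + int q^2" "int a * int x' + int b = int y' + int q^2"
    "int a' * int x + int b' = int y + int q^2" "int a' * int x' + int b' = int y' + int q^2"
    using eq by (simp_all flip: of_nat_mult of_nat_add of_nat_power)
  then have "(int a - int a') * (int x - int x') = 0"
    by (simp add: algebra_simps)
  then have "a = a'" using \<open>x \<noteq> x'\<close> by auto
  with eq show ?thesis by auto
qed

lemma partial_linear_space_points_lines:
  "partial_linear_space (points q) (lines q) (through q) q"
proof
  show "finite (points q)" "finite (lines q)"
    by (auto simp: points_def lines_def)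
  show "through q p \<subseteq> lines q" for p by (auto simp: through_def)
  then have "finite (through q p)" for p
    by (rule finite_subset) (auto simp: lines_def)
  then show "card (through q p \<inter> through q p') \<le> 1" if "p \<noteq> p'" for p p'
    using through_Int[OF that] by (subst One_nat_def, subst card_le_Suc0_iff_eq) auto
qed (rule card_through)

lemma pair_graph_incidence_graph: "pair_graph (incidence_graph q)"
proof -
  have fin: "finite (points q)" "finite (lines q)"
    by (auto simp: points_def lines_def)
  let ?V = "point_vertex ` points q \<union> line_vertex ` lines q"
  have sub: "parcs (incidence_graph q) \<subseteq> ?V \<times> ?V"
    by (auto simp: incidence_graph_def through_def)
  have V: "pverts (incidence_graph q) = ?V" by (simp add: incidence_graph_def)
  show ?thesis
  proof
    show "fst e \<in> pverts (incidence_graph q)" "snd e \<in> pverts (incidence_graph q)"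
      if "e \<in> parcs (incidence_graph q)" for e
      using that sub V by auto
    show "finite (pverts (incidence_graph q))" using fin V by simp
    show "finite (parcs (incidence_graph q))"
      using sub fin by (auto intro: finite_subset)
    show "fst e \<noteq> snd e" if "e \<in> parcs (incidence_graph q)" for e
      using that by (auto simp: incidence_graph_def)
    show "symmetric (incidence_graph q)"
      by (auto simp: symmetric_def sym_def incidence_graph_def)
  qed
qed

lemma bipartite_incidence_graph: "bipartite (incidence_graph q)"
  unfolding bipartite_def
  by (rule exI[of _ "point_vertex ` points q"], rule exI[of _ "line_vertex ` lines q"])
    (auto simp: incidence_graph_def through_def)

lemma card_pverts_incidence_graph: "card (pverts (incidence_graph q)) = 3 * q^3"
proof -
  have "card (pverts (incidence_graph q)) = card (point_vertex ` points q) + card (line_vertex ` lines q)"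
    unfolding incidence_graph_def pair_pre_digraph.simps
    by (rule card_Un_disjoint) (auto simp: points_def lines_def)
  also have "\<dots> = 3 * q^3"
    by (subst (1 2) card_image) (auto simp: inj_on_def card_points card_lines)
  finally show ?thesis .
qed

lemma xc_STAB_incidence_graph_ge:
  assumes k: "k \<ge> 2" and q: "q > k" and r: "r ^ 3 \<le> k"
    and \<sigma>: "\<sigma> = (1 - (1 - 1 / real k) ^ q) ^ r"
    and \<sigma>1: "real r * \<sigma> \<le> 1" and \<sigma>2: "real (q ^ 4) * \<sigma> \<le> 2 * real k"
  shows "real (q ^ 4) \<le> 8 * real k * real (xc (STAB (incidence_graph q)))"
proof -
  interpret partial_linear_space "points q" "lines q" "through q" q
    by (rule partial_linear_space_points_lines)
  let ?G = "incidence_graph q"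
  obtain \<U> where \<U>: "finite \<U>" "card \<U> \<le> xc (STAB ?G)"
    "\<And>u v S. (u, v) \<in> parcs ?G \<Longrightarrow> stable_set ?G S \<Longrightarrow> u \<notin> S \<Longrightarrow> v \<notin> S
       \<Longrightarrow> \<exists>U\<in>\<U>. u \<in> U \<and> v \<in> U \<and> U \<inter> S = {}"
    using rectangle_cover_STAB[OF pair_graph_incidence_graph] by blast
  define R where "R U = ({p \<in> points q. point_vertex p \<in> U}, {l \<in> lines q. line_vertex l \<in> U})" for U
  have "real (card (points q) * q) \<le> 8 * real k * real (card (R ` \<U>))"
  proof (rule card_rectangle_cover_ge[OF k q r \<sigma> \<sigma>1])
    show "real (card (points q) * q) * \<sigma> \<le> 2 * real k"
      using \<sigma>2 by (simp add: card_points eval_nat_numeral mult_ac)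
    show "finite (R ` \<U>)" using \<U>(1) by simp
    show "X \<subseteq> points q \<and> Y \<subseteq> lines q" if "(X, Y) \<in> R ` \<U>" for X Y
      using that by (auto simp: R_def)
    fix p l f assume p: "p \<in> points q" and l: "l \<in> through q p" and f: "f \<in> colourings k {l} {p}"
    \<comment> \<open>\<open>f\<close> being in \<open>colourings k {l} {p}\<close> says precisely
      that this set misses \<open>l\<close> and \<open>p\<close>.\<close>
    define S where "S = line_vertex ` {l' \<in> lines q. f l' = 0} \<union>
      point_vertex ` {p' \<in> points q. \<forall>l'\<in>through q p'. f l' \<noteq> 0}"
    have "stable_set ?G S"
      by (auto simp: stable_set_def S_def incidence_graph_def simp del: neq0_conv)
    moreover have "(point_vertex p, line_vertex l) \<in> parcs ?G"
      unfolding incidence_graph_def pair_pre_digraph.simps using p l by blast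
    moreover have "point_vertex p \<notin> S" "line_vertex l \<notin> S"
      using f by (auto simp: S_def colourings_def simp del: neq0_conv)
    ultimately obtain U where U: "U \<in> \<U>" "point_vertex p \<in> U" "line_vertex l \<in> U" "U \<inter> S = {}"
      using \<U>(3) by blast
    \<comment> \<open>Disjointness of \<open>U\<close> from \<open>S\<close> says that the lines in
      \<open>U\<close> are unselected and the points in \<open>U\<close> are hit, so
      \<open>f\<close> lies in the event of the rectangle \<open>R U\<close>.\<close>
    have "f l' \<noteq> 0" if "l' \<in> lines q" "line_vertex l' \<in> U" for l'
      using that U(4) by (auto simp: S_def)
    moreover have "\<exists>l'\<in>through q p'. f l' = 0" if "p' \<in> points q" "point_vertex p' \<in> U" for p'
      using that U(4) by (auto simp: S_def)
    ultimately have "f \<in> colourings k (snd (R U)) (fst (R U))"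
      using f by (auto simp: colourings_def R_def)
    moreover have "p \<in> fst (R U)" "l \<in> snd (R U)"
      using p l U N_sub[OF p] by (auto simp: R_def)
    ultimately show "\<exists>(X, Y)\<in>R ` \<U>. p \<in> X \<and> l \<in> Y \<and> f \<in> colourings k Y X"
      using U(1) by (auto simp: case_prod_unfold)
  qed
  also have "\<dots> \<le> 8 * real k * real (xc (STAB ?G))"
    using card_image_le[OF \<U>(1), of R] \<U>(2) by (intro mult_left_mono) auto
  finally show ?thesis
    by (simp add: card_points eval_nat_numeral mult_ac)
qed

text \<open>The choice \<open>q = j k\<close> with \<open>k = r\<^sup>3\<close> and \<open>r = 8\<^sup>j\<close>: a point is missed with probability at least
  \<open>4\<^sup>-\<^sup>j\<close>, so \<open>r\<close> independent points are all hit with probability at most \<open>exp (- 2\<^sup>j)\<close>, which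
  is smaller than any power of \<open>q\<close>.\<close>

definition plane_order :: "nat \<Rightarrow> nat" where
  "plane_order j = j * 512 ^ j"

lemma plane_order_le: "plane_order j \<le> 2 ^ (10 * j)"
proof -
  have "j * 512 ^ j \<le> 2 ^ j * 512 ^ j"
    by (intro mult_right_mono) (auto intro: less_imp_le)
  also have "\<dots> = (2 * 512) ^ j" by (simp only: power_mult_distrib)
  also have "\<dots> = 2 ^ (10 * j)" by (simp add: power_mult)
  finally show ?thesis by (simp add: plane_order_def)
qed

text \<open>As \<open>q^4 = k * (q^3 * j)\<close>, the factor \<open>k\<close> cancels and
  \<open>j\<close>, of order log \<open>q\<close>, remains. The side conditions hold because
  \<open>\<sigma>\<close> is at most \<open>2^(-40 j)\<close>, while \<open>r\<close> and
  \<open>q^4\<close> are at most \<open>2^(40 j)\<close>.\<close>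

lemma xc_STAB_incidence_graph_plane_order_ge:
  assumes j: "j \<ge> 9"
  shows "real (plane_order j ^ 3 * j) \<le> 8 * real (xc (STAB (incidence_graph (plane_order j))))"
proof -
  define r :: nat where "r = 8 ^ j"
  define k :: nat where "k = 512 ^ j"
  let ?q = "plane_order j" and ?s = "1 - 1 / real k"
  define \<sigma> where "\<sigma> = (1 - ?s ^ ?q) ^ r"
  have "512 ^ 1 \<le> k" unfolding k_def using j by (intro power_increasing) auto
  then have k: "k \<ge> 2" by simp
  have kj: "?q = k * j" by (simp add: plane_order_def k_def)
  have s: "0 \<le> ?s" "?s \<le> 1" using k by auto
  \<comment> \<open>Bernoulli's inequality with exponent \<open>k\<close> would only give 0; with
    \<open>k / 2\<close> it gives 1/2, and squaring gives 1/4.\<close>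
  obtain m where m: "k = 2 * m" using j by (cases j) (auto simp: k_def)
  have "1/2 \<le> ?s ^ m"
    using Bernoulli_inequality[of "- 1 / real k" m] k m by simp
  then have "(1/2) ^ 2 \<le> (?s ^ m) ^ 2" by (intro power_mono) auto
  moreover have "(?s ^ m) ^ 2 = ?s ^ k" using m by (metis power_mult mult.commute)
  ultimately have "1/4 \<le> ?s ^ k" by (simp add: power2_eq_square)
  then have "(1/4) ^ j \<le> (?s ^ k) ^ j" by (intro power_mono) auto
  then have sq: "(1/4) ^ j \<le> ?s ^ ?q" by (simp add: kj power_mult)
  \<comment> \<open>The 40 comes from \<open>q^4 \<le> (2^(10 j))^4\<close>. The inequality fails at
    \<open>j = 8\<close>, hence the bound 9.\<close>
  have "40 * j \<le> 2 ^ j" using j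
  proof (induction j rule: nat_induct_at_least)
    case (Suc n)
    have "(40::nat) \<le> 2 ^ n"
    proof -
      have "2 ^ 9 \<le> (2::nat) ^ n" using Suc.hyps by (intro power_increasing) auto
      then show ?thesis by simp
    qed
    with Suc show ?case by simp
  qed simp
  then have pow: "(1/2::real) ^ (2 ^ j) \<le> (1/2) ^ (40 * j)"
    by (intro power_decreasing) auto
  have \<sigma>0: "0 \<le> \<sigma>" unfolding \<sigma>_def using s by (auto intro!: zero_le_power power_le_one)
  have "\<sigma> \<le> (1 - (1/4) ^ j) ^ r"
    unfolding \<sigma>_def using sq s by (intro power_mono) (auto intro: power_le_one)
  also have "\<dots> \<le> exp (- ((1/4) ^ j)) ^ r"
    using exp_ge_add_one_self[of "- ((1/4) ^ j)"] by (intro power_mono) (auto intro: power_le_one)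
  also have "\<dots> = exp (- (2 ^ j))"
  proof -
    have "real r * (1/4) ^ j = 2 ^ j"
      unfolding r_def by (simp flip: power_mult_distrib)
    then show ?thesis by (simp add: exp_of_nat_mult[symmetric])
  qed
  also have "\<dots> = exp (- 1) ^ (2 ^ j)"
    by (simp add: exp_of_nat_mult[symmetric])
  also have "\<dots> \<le> (1/2) ^ (2 ^ j)"
    using exp_ge_add_one_self[of 1] by (intro power_mono) (auto simp: exp_minus field_simps)
  finally have \<sigma>: "\<sigma> \<le> (1/2) ^ (40 * j)" using pow by linarith
  have "real r \<le> 2 ^ (40 * j)"
  proof -
    have "real r = 2 ^ (3 * j)" by (simp add: r_def power_mult)
    also have "\<dots> \<le> 2 ^ (40 * j)" by (intro power_increasing) auto
    finally show ?thesis .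
  qed
  then have "real r * \<sigma> \<le> 2 ^ (40 * j) * (1/2) ^ (40 * j)"
    using \<sigma> \<sigma>0 by (intro mult_mono) auto
  then have \<sigma>1: "real r * \<sigma> \<le> 1" by (simp flip: power_mult_distrib)
  have "real (?q ^ 4) \<le> 2 ^ (40 * j)"
  proof -
    have "?q ^ 4 \<le> (2 ^ (10 * j)) ^ 4" using plane_order_le by (intro power_mono) auto
    then have "?q ^ 4 \<le> 2 ^ (40 * j)" by (simp flip: power_mult)
    then have "real (?q ^ 4) \<le> real (2 ^ (40 * j))" by (simp only: of_nat_le_iff)
    then show ?thesis by simp
  qed
  then have "real (?q ^ 4) * \<sigma> \<le> 2 ^ (40 * j) * (1/2) ^ (40 * j)"
    using \<sigma> \<sigma>0 by (intro mult_mono) auto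
  then have "real (?q ^ 4) * \<sigma> \<le> 1" by (simp flip: power_mult_distrib)
  then have \<sigma>2: "real (?q ^ 4) * \<sigma> \<le> 2 * real k" using k by linarith
  have "r ^ 3 = (8 ^ 3) ^ j" unfolding r_def by (simp only: power_mult[symmetric] mult.commute)
  then have "r ^ 3 \<le> k" by (simp add: k_def)
  moreover have "?q > k" using kj k j by simp
  ultimately have "real (?q ^ 4) \<le> 8 * real k * real (xc (STAB (incidence_graph ?q)))"
    using xc_STAB_incidence_graph_ge[OF k _ _ \<sigma>_def \<sigma>1 \<sigma>2] by simp
  moreover have "real (?q ^ 4) = real k * real (?q ^ 3 * j)"
    using kj by (simp add: eval_nat_numeral)
  ultimately have "real k * real (?q ^ 3 * j) \<le> real k * (8 * real (xc (STAB (incidence_graph ?q))))"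
    by (simp add: mult_ac)
  then show ?thesis
    by (rule mult_left_le_imp_le) (use k in simp)
qed

section \<open>The infinite class of graphs\<close>

lemma strict_mono_plane_order: "strict_mono plane_order"
proof (rule strict_monoI_Suc)
  fix n
  have "n * 512 ^ n \<le> n * (512 :: nat) ^ Suc n" by (intro mult_left_mono power_increasing) auto
  also have "\<dots> < Suc n * 512 ^ Suc n" by simp
  finally show "plane_order n < plane_order (Suc n)" by (simp only: plane_order_def)
qed

lemma digraph_iso_card_verts:
  assumes "digraph_iso G H"
  shows "card (verts G) = card (verts H)"
proof -
  obtain hom where "pre_digraph.digraph_isomorphism G hom" "H = app_iso hom G"
    using assms by (auto simp: digraph_iso_def)
  then show ?thesis
    by (simp add: card_image pre_digraph.digraph_isomorphism_inj_on_verts)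
qed

theorem theorem2:
  shows "\<exists>C :: nat pair_pre_digraph set.
    infinite C \<and>
    pairwise (\<lambda>G H. \<not> digraph_iso (with_proj G) (with_proj H)) C \<and>
    (\<forall>G\<in>C. pair_graph G \<and> bipartite G) \<and>
    (\<exists>c::real. c > 0 \<and> (\<exists>n\<^sub>0::nat. \<forall>G\<in>C. \<forall>n. n = card (pverts G) \<and> n \<ge> n\<^sub>0 \<longrightarrow>
       real (xc (STAB G)) \<ge> c * (real n * ln (real n))))"
proof (intro exI conjI)
  let ?G = "\<lambda>j. incidence_graph (plane_order j)"
  have card_inj: "i = j" if "card (pverts (?G i)) = card (pverts (?G j))" for i j
  proof -
    have "plane_order i ^ 3 = plane_order j ^ 3" using that by (simp add: card_pverts_incidence_graph)
    then have "plane_order i = plane_order j" by (rule power_eq_imp_eq_base) auto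
    then show ?thesis using strict_mono_plane_order by (simp add: strict_mono_eq)
  qed
  then have "inj_on ?G {9..}" by (auto intro: inj_onI)
  then show "infinite (?G ` {9..})"
    by (simp add: finite_image_iff infinite_Ici)
  show "pairwise (\<lambda>G H. \<not> digraph_iso (with_proj G) (with_proj H)) (?G ` {9..})"
  proof (clarsimp simp: pairwise_def)
    fix i j assume "?G i \<noteq> ?G j" "digraph_iso (with_proj (?G i)) (with_proj (?G j))"
    then show False using card_inj[of i j] digraph_iso_card_verts by fastforce
  qed
  show "\<forall>G\<in>?G ` {9..}. pair_graph G \<and> bipartite G"
    by (simp add: pair_graph_incidence_graph bipartite_incidence_graph)
  \<comment> \<open>With \<open>n = 3 q^3\<close> and \<open>ln n \<le> 32 j\<close>, the product
    \<open>n ln n\<close> is at most \<open>96 q^3 j\<close>; the bound on \<open>xc\<close>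
    contributes the further factor 8.\<close>
  show "(1/768::real) > 0" by simp
  show "\<forall>G\<in>?G ` {9..}. \<forall>n. n = card (pverts G) \<and> n \<ge> 0 \<longrightarrow>
       real (xc (STAB G)) \<ge> (1/768) * (real n * ln (real n))"
  proof (intro ballI allI impI)
    fix G n assume "G \<in> ?G ` {9..}" and n: "n = card (pverts G) \<and> n \<ge> 0"
    then obtain j where j: "j \<ge> 9" and G: "G = ?G j" by auto
    let ?q = "plane_order j"
    have q: "?q > 0" using j by (simp add: plane_order_def)
    have "3 * ?q ^ 3 \<le> 2 ^ (2 * j) * (2 ^ (10 * j)) ^ 3"
    proof (intro mult_mono power_mono plane_order_le)
      have "2 ^ 2 \<le> (2::nat) ^ (2 * j)" using j by (intro power_increasing) auto
      then show "3 \<le> (2::nat) ^ (2 * j)" by simp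
    qed auto
    also have "\<dots> = 2 ^ (32 * j)" by (simp flip: power_mult power_add)
    finally have "real (3 * ?q ^ 3) \<le> real (2 ^ (32 * j))" by (simp only: of_nat_le_iff)
    then have "ln (real (3 * ?q ^ 3)) \<le> ln (2 ^ (32 * j))"
      using q by (subst ln_le_cancel_iff) auto
    also have "\<dots> = real (32 * j) * ln 2" by (simp add: ln_realpow)
    also have "\<dots> \<le> real (32 * j) * 1"
      using ln_le_minus_one[of 2] by (intro mult_left_mono) auto
    finally have "real (3 * ?q ^ 3) * ln (real (3 * ?q ^ 3)) \<le> real (3 * ?q ^ 3) * real (32 * j)"
      by (intro mult_left_mono) auto
    also have "\<dots> = 96 * real (?q ^ 3 * j)" by simp
    also have "\<dots> \<le> 96 * (8 * real (xc (STAB (?G j))))"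
      by (intro mult_left_mono xc_STAB_incidence_graph_plane_order_ge j) simp
    finally show "real (xc (STAB G)) \<ge> (1/768) * (real n * ln (real n))"
      using n by (simp add: G card_pverts_incidence_graph)
  qed
qed

end
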